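(* Let $n\geq 1$ and let $G$ be a connected graph on $n$ vertices. Then $$\binom{n+1}{2}\leq F(G)\leq M,\qquad M=\sum_{i=1}^{n}\binom{n}{i}h_i .$$ In particular, among all connected graphs on $n$ vertices the core index is maximized by the complete graph $K_n$ (with $F(K_n)=M$) and minimized by the path $P_n$ (with $F(P_n)=\binom{n+1}{2}$).
   Context: All graphs are finite, simple and undirected. A connected subgraph of a graph $G=(V,E)$ is a graph $(V',E')$ with $\emptyset\neq V'\subseteq V$, $E'\subseteq E$, every edge of $E'$ having both endpoints in $V'$, and $(V',E')$ connected. Distinct pairs $(V',E')$ are counted as distinct subgraphs. The core index $F(G)$ is the number of connected subgraphs of $G$. Here $h_i$ denotes the number of connected labeled graphs on $i$ labeled vertices (so $h_1=1,h_2=1,h_3=4,\dots$). *)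

theory Defs
  imports Complex_Main
begin

text \<open>
  A graph is a pair of a vertex set and a set of edges, where an edge is the two-element set
  of its endpoints.
\<close>

type_synonym 'a ugraph = "'a set \<times> 'a set set"

abbreviation verts :: "'a ugraph \<Rightarrow> 'a set" where
  "verts G \<equiv> fst G"

abbreviation edges :: "'a ugraph \<Rightarrow> 'a set set" where
  "edges G \<equiv> snd G"

definition simple_graph :: "'a ugraph \<Rightarrow> bool" where
  "simple_graph G \<longleftrightarrow>
     finite (verts G) \<and> (\<forall>e \<in> edges G. e \<subseteq> verts G \<and> card e = 2)"

definition adj :: "'a ugraph \<Rightarrow> ('a \<times> 'a) set" where
  "adj G = {(u, v). {u, v} \<in> edges G}"

text \<open>The graph without vertices does not count as connected.\<close>

definition connected_graph :: "'a ugraph \<Rightarrow> bool" where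
  "connected_graph G \<longleftrightarrow>
     simple_graph G \<and> verts G \<noteq> {} \<and>
     (\<forall>u \<in> verts G. \<forall>v \<in> verts G. (u, v) \<in> (adj G)\<^sup>*)"

definition connected_subgraphs :: "'a ugraph \<Rightarrow> 'a ugraph set" where
  "connected_subgraphs G =
     {H. verts H \<subseteq> verts G \<and> edges H \<subseteq> edges G \<and> connected_graph H}"

definition core_index :: "'a ugraph \<Rightarrow> nat" where
  "core_index G = card (connected_subgraphs G)"

definition num_connected_labeled :: "nat \<Rightarrow> nat" where
  "num_connected_labeled i =
     card {H :: nat ugraph. verts H = {1..i} \<and> connected_graph H}"

definition complete_graph :: "nat \<Rightarrow> nat ugraph" where
  "complete_graph n = ({1..n}, {e. e \<subseteq> {1..n} \<and> card e = 2})"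

definition path_graph :: "nat \<Rightarrow> nat ugraph" where
  "path_graph n = ({1..n}, {{i, i + 1} | i. 1 \<le> i \<and> i < n})"

end

theory Submission
  imports Defs
begin

text \<open>
  Lower bound: a connected subgraph that misses some vertex can always be extended by one vertex.
  Hence through every vertex there are connected subgraphs with 1, 2, \<dots>, n vertices, and
  some connected subgraph \<open>H\<close> misses exactly one vertex \<open>v\<close>. By induction
  \<open>H\<close> contributes at least \<open>n choose 2\<close> connected subgraphs, and there are at least
  \<open>n\<close> more through \<open>v\<close>.

  Upper bound: relabelling the vertices embeds the connected subgraphs of any graph on \<open>n\<close>
  vertices into those of the complete graph, which are counted by their vertex sets.
  A connected subgraph of the path is determined by its least and greatest vertex, because
  omitting an edge between them would disconnect it.
\<close>

section \<open>Finiteness, reachability and edge cuts\<close>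

lemma edges_subset_Pow: "simple_graph G \<Longrightarrow> edges G \<subseteq> Pow (verts G)"
  by (auto simp: simple_graph_def)

lemma connected_graph_simple: "connected_graph G \<Longrightarrow> simple_graph G"
  by (simp add: connected_graph_def)

lemma finite_connected_subgraphs:
  assumes "simple_graph G"
  shows "finite (connected_subgraphs G)"
proof -
  have "finite (verts G)" "finite (edges G)"
    using assms edges_subset_Pow[OF assms]
    by (auto simp: simple_graph_def intro: finite_subset)
  moreover have "connected_subgraphs G \<subseteq> Pow (verts G) \<times> Pow (edges G)"
    by (auto simp: connected_subgraphs_def)
  ultimately show ?thesis
    by (meson finite_Pow_iff finite_SigmaI finite_subset)
qed

lemma connected_subgraphs_trans:
  "H \<in> connected_subgraphs G \<Longrightarrow> connected_subgraphs H \<subseteq> connected_subgraphs G"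
  by (auto simp: connected_subgraphs_def)

lemma adj_sym: "sym (adj G)"
  by (auto simp: sym_def adj_def insert_commute)

lemma adj_rtrancl_sym: "(u, v) \<in> (adj G)\<^sup>* \<Longrightarrow> (v, u) \<in> (adj G)\<^sup>*"
  using adj_sym sym_rtrancl symD by metis

lemma connected_graph_if_root:
  assumes "simple_graph G" "r \<in> verts G"
    and "\<And>v. v \<in> verts G \<Longrightarrow> (r, v) \<in> (adj G)\<^sup>*"
  shows "connected_graph G"
  unfolding connected_graph_def
  using assms by (auto intro: rtrancl_trans[OF adj_rtrancl_sym])

text \<open>If no edge left \<open>S\<close>, then \<open>S\<close> would be closed under
  reachability and would contain \<open>v\<close>. This one cut argument serves both for enlarging a
  connected subgraph and for locating the edges of a subgraph of the path.\<close>

lemma crossing_edge: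
  assumes "(u, v) \<in> (adj G)\<^sup>*" "u \<in> S" "v \<notin> S"
  obtains x y where "{x, y} \<in> edges G" "x \<in> S" "y \<notin> S"
proof -
  have "v \<in> S" if "\<And>x y. {x, y} \<in> edges G \<Longrightarrow> x \<in> S \<Longrightarrow> y \<in> S"
    using assms(1,2)
    by (induction rule: rtrancl_induct) (auto simp: adj_def intro: that)
  then show ?thesis
    using assms(3) that by blast
qed


subsection \<open>Lower bound\<close>

lemma singleton_connected_subgraph:
  "v \<in> verts G \<Longrightarrow> ({v}, {}) \<in> connected_subgraphs G"
  by (auto simp: connected_subgraphs_def connected_graph_def simple_graph_def)

text \<open>Connectivity of \<open>G\<close> forces an edge out of \<open>verts H\<close>;
  \<open>H'\<close> is \<open>H\<close> with that edge and its outer endpoint attached. The inner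
  endpoint \<open>x\<close> is the root: it reaches the old vertices inside \<open>H\<close> and
  \<open>y\<close> along the new edge.\<close>

lemma connected_subgraph_extend:
  assumes G: "connected_graph G" and H: "H \<in> connected_subgraphs G"
    and ne: "verts H \<noteq> verts G"
  obtains H' y where "H' \<in> connected_subgraphs G" "y \<notin> verts H" "verts H' = insert y (verts H)"
proof -
  have cH: "connected_graph H" and sub: "verts H \<subseteq> verts G" "edges H \<subseteq> edges G"
    using H by (auto simp: connected_subgraphs_def)
  obtain u v where "u \<in> verts H" "v \<in> verts G" "v \<notin> verts H"
    using cH sub ne by (auto simp: connected_graph_def)
  moreover from this have "(u, v) \<in> (adj G)\<^sup>*"
    using G sub by (auto simp: connected_graph_def)
  ultimately obtain x y where e: "{x, y} \<in> edges G" "x \<in> verts H" "y \<notin> verts H"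
    using crossing_edge by metis
  have sG: "simple_graph G" and sH: "simple_graph H"
    using G cH by (auto simp: connected_graph_def)
  let ?H = "(insert y (verts H), insert {x, y} (edges H))"
  have y: "y \<in> verts G" and c2: "card {x, y} = 2"
    using e(1) sG by (auto simp: simple_graph_def)
  have "connected_graph ?H"
  proof (rule connected_graph_if_root)
    show "simple_graph ?H"
      using sH e c2 by (auto simp: simple_graph_def)
    show "x \<in> verts ?H"
      using e by simp
    have mono: "(adj H)\<^sup>* \<subseteq> (adj ?H)\<^sup>*"
      by (rule rtrancl_mono) (auto simp: adj_def)
    have xy: "(x, y) \<in> (adj ?H)\<^sup>*"
      by (auto simp: adj_def)
    fix w assume "w \<in> verts ?H"
    then show "(x, w) \<in> (adj ?H)\<^sup>*"
      using cH e(2) mono xy by (auto simp: connected_graph_def)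
  qed
  then have "?H \<in> connected_subgraphs G"
    using sub e y by (auto simp: connected_subgraphs_def)
  then show ?thesis
    using e(3) that by auto
qed

lemma connected_subgraph_of_card:
  assumes G: "connected_graph G" and v: "v \<in> verts G"
  shows "k < card (verts G) \<Longrightarrow>
    \<exists>H \<in> connected_subgraphs G. v \<in> verts H \<and> card (verts H) = Suc k"
proof (induction k)
  case 0
  show ?case
    using singleton_connected_subgraph[OF v] by (intro bexI) auto
next
  case (Suc k)
  then obtain H where H: "H \<in> connected_subgraphs G" "v \<in> verts H" "card (verts H) = Suc k"
    by auto
  with Suc.prems obtain H' y where
    "H' \<in> connected_subgraphs G" "y \<notin> verts H" "verts H' = insert y (verts H)"
    using connected_subgraph_extend[OF G H(1)] by (metis less_irrefl)
  moreover have "finite (verts H)"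
    using H(3) card.infinite by fastforce
  ultimately show ?case
    using H by (intro bexI[of _ H']) auto
qed

text \<open>Growing from \<open>v\<close> one vertex at a time realises each size from 1 to
  \<open>card (verts G)\<close>, so counting vertices maps \<open>?S\<close> onto at least that many
  values.\<close>

lemma card_connected_subgraphs_through:
  assumes G: "connected_graph G" and v: "v \<in> verts G"
  shows "card (verts G) \<le> card {H \<in> connected_subgraphs G. v \<in> verts H}" (is "_ \<le> card ?S")
proof -
  have "{1..card (verts G)} \<subseteq> (card \<circ> fst) ` ?S"
  proof
    fix k assume "k \<in> {1..card (verts G)}"
    then obtain j where "k = Suc j" "j < card (verts G)"
      by (cases k) auto
    with connected_subgraph_of_card[OF G v, of j] show "k \<in> (card \<circ> fst) ` ?S"
      by force
  qed
  moreover have "finite ?S"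
    by (simp add: G connected_graph_simple finite_connected_subgraphs)
  ultimately show ?thesis
    using surj_card_le by fastforce
qed

lemma core_index_ge:
  "connected_graph G \<Longrightarrow> card (verts G) = n \<Longrightarrow> (n + 1) choose 2 \<le> core_index G"
proof (induction n arbitrary: G)
  case 0
  then show ?case by (simp add: numeral_2_eq_2)
next
  case (Suc n)
  let ?C = "connected_subgraphs G"
  have fin: "finite ?C"
    by (simp add: Suc.prems(1) connected_graph_simple finite_connected_subgraphs)
  obtain r where r: "r \<in> verts G"
    using Suc.prems by (auto simp: connected_graph_def)
  \<comment> \<open>A single vertex is treated apart: deleting it would leave the graph without
    vertices, which is not connected.\<close>
  show ?case
  proof (cases n)
    case 0
    have "core_index G \<noteq> 0"
      using singleton_connected_subgraph[OF r] fin by (auto simp: core_index_def)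
    with 0 show ?thesis
      by (simp add: numeral_2_eq_2)
  next
    case (Suc m)
    obtain H where H: "H \<in> ?C" "card (verts H) = n"
      using connected_subgraph_of_card[OF Suc.prems(1) r, of m] Suc.prems Suc by auto
    have cH: "connected_graph H" "verts H \<subseteq> verts G"
      using H by (auto simp: connected_subgraphs_def)
    obtain v where v: "v \<in> verts G" "v \<notin> verts H"
      using cH H Suc.prems(2) by (metis n_not_Suc_n subsetI subset_antisym)
    let ?T = "{K \<in> ?C. v \<in> verts K}"
    \<comment> \<open>Pascal's rule; the summand \<open>Suc n\<close> is the number of vertices of
      \<open>G\<close>, which bounds the number of subgraphs through \<open>v\<close>.\<close>
    have "Suc (Suc n) choose 2 = ((n + 1) choose 2) + Suc n"
      by (simp add: numeral_2_eq_2)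
    also have "\<dots> \<le> card (connected_subgraphs H) + card ?T"
      using Suc.IH[OF cH(1) H(2)] card_connected_subgraphs_through[OF Suc.prems(1) v(1)] Suc.prems(2)
      by (simp add: core_index_def)
    also have "\<dots> = card (connected_subgraphs H \<union> ?T)"
    proof (rule card_Un_disjoint[symmetric])
      show "finite (connected_subgraphs H)" "finite ?T"
        using fin connected_subgraphs_trans[OF H(1)] by (auto intro: finite_subset)
      \<comment> \<open>Subgraphs of \<open>H\<close> avoid \<open>v\<close>, while those in
        \<open>?T\<close> contain it.\<close>
      show "connected_subgraphs H \<inter> ?T = {}"
        using v by (auto simp: connected_subgraphs_def)
    qed
    also have "\<dots> \<le> card ?C"
      using fin connected_subgraphs_trans[OF H(1)] by (intro card_mono) auto
    finally show ?thesis
      by (simp add: core_index_def)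
  qed
qed


subsection \<open>Relabelling and the complete graph\<close>

definition map_graph :: "('a \<Rightarrow> 'b) \<Rightarrow> 'a ugraph \<Rightarrow> 'b ugraph" where
  "map_graph f G = (f ` verts G, image f ` edges G)"

text \<open>Injectivity keeps the image of an edge a two-element set, and walks are carried to walks
  edge by edge.\<close>

lemma connected_map_graph:
  assumes G: "connected_graph G" and inj: "inj_on f (verts G)"
  shows "connected_graph (map_graph f G)"
proof -
  have sG: "simple_graph G"
    using G by (auto simp: connected_graph_def)
  have "card (f ` e) = 2" if "e \<in> edges G" for e
    using that sG inj card_image inj_on_subset unfolding simple_graph_def by metis
  then have "simple_graph (map_graph f G)"
    using sG by (auto simp: simple_graph_def map_graph_def)
  moreover have "(f u, f v) \<in> (adj (map_graph f G))\<^sup>*" if "(u, v) \<in> (adj G)\<^sup>*" for u v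
    using that
  proof (induction rule: rtrancl_induct)
    case (step y z)
    then have "f ` {y, z} \<in> edges (map_graph f G)"
      unfolding map_graph_def adj_def snd_conv by blast
    then have "(f y, f z) \<in> adj (map_graph f G)"
      by (simp add: adj_def)
    with step show ?case
      by (meson rtrancl.rtrancl_into_rtrancl)
  qed simp
  ultimately show ?thesis
    using G by (auto simp: connected_graph_def map_graph_def)
qed

lemma map_graph_inverse:
  assumes "simple_graph G" and "\<And>x. x \<in> verts G \<Longrightarrow> g (f x) = x"
  shows "map_graph g (map_graph f G) = G"
proof -
  have img: "g ` f ` A = A" if "A \<subseteq> verts G" for A
    using assms(2) that by (force simp: image_iff)
  have "image g ` image f ` edges G = (\<lambda>e. e) ` edges G"
    unfolding image_image
    using img edges_subset_Pow[OF assms(1)] by (intro image_cong) (auto simp: image_image)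
  then show ?thesis
    by (simp add: map_graph_def img prod_eq_iff)
qed

text \<open>Simplicity confines the edges to \<open>V\<close>, where \<open>the_inv_into V f\<close>
  undoes \<open>f\<close>; relabelling by it therefore recovers the graph.\<close>

lemma inj_on_map_graph:
  assumes "inj_on f V"
  shows "inj_on (map_graph f) {G. simple_graph G \<and> verts G \<subseteq> V}"
proof (rule inj_on_inverseI)
  fix G assume "G \<in> {G. simple_graph G \<and> verts G \<subseteq> V}"
  then show "map_graph (the_inv_into V f) (map_graph f G) = G"
    using assms by (intro map_graph_inverse) (auto simp: the_inv_into_f_f)
qed

section \<open>Counting connected graphs on a fixed vertex set\<close>

lemma finite_connected_graphs_on:
  assumes "finite S"
  shows "finite {H. verts H = S \<and> connected_graph H}"
proof (rule finite_subset)
  show "{H. verts H = S \<and> connected_graph H} \<subseteq> {S} \<times> Pow (Pow S)"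
    using edges_subset_Pow by (auto simp: connected_graph_def) fastforce
qed (use assms in auto)

lemma card_connected_graphs_le:
  assumes "bij_betw f S T" "finite T"
  shows "card {H. verts H = S \<and> connected_graph H} \<le> card {H. verts H = T \<and> connected_graph H}"
proof (rule card_inj_on_le[where f = "map_graph f"])
  have inj: "inj_on f S" and im: "f ` S = T"
    using assms by (auto simp: bij_betw_def)
  show "inj_on (map_graph f) {H. verts H = S \<and> connected_graph H}"
    by (rule inj_on_subset[OF inj_on_map_graph[OF inj]]) (auto simp: connected_graph_def)
  show "map_graph f ` {H. verts H = S \<and> connected_graph H} \<subseteq> {H. verts H = T \<and> connected_graph H}"
    using inj im connected_map_graph by (fastforce simp: map_graph_def)
  show "finite {H. verts H = T \<and> connected_graph H}"
    using assms finite_connected_graphs_on by blast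
qed

text \<open>The previous inequality is applied to a bijection onto \<open>{1..card S}\<close> and to
  its inverse.\<close>

lemma card_connected_graphs_on:
  assumes "finite S"
  shows "card {H. verts H = S \<and> connected_graph H} = num_connected_labeled (card S)"
proof -
  obtain f where "bij_betw f S {1..card S}"
    using assms finite_same_card_bij[of S "{1..card S}"] by auto
  then show ?thesis
    unfolding num_connected_labeled_def
    by (intro antisym card_connected_graphs_le[of f] card_connected_graphs_le[OF bij_betw_inv_into])
      (simp_all add: assms)
qed

section \<open>Connected subgraphs of the complete graph\<close>

lemma connected_subgraphs_complete:
  "connected_subgraphs (complete_graph n) = {H. verts H \<subseteq> {1..n} \<and> connected_graph H}"
proof -
  have "edges H \<subseteq> {e. e \<subseteq> {1..n} \<and> card e = 2}"
    if "verts H \<subseteq> {1..n}" "connected_graph H" for H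
    using that connected_graph_simple[of H] unfolding simple_graph_def by blast
  then show ?thesis
    unfolding connected_subgraphs_def complete_graph_def fst_conv snd_conv by blast
qed

lemma core_index_complete:
  "core_index (complete_graph n) = (\<Sum>i = 1..n. (n choose i) * num_connected_labeled i)"
proof -
  let ?N = "\<lambda>S :: nat set. {H. verts H = S \<and> connected_graph H}"
  let ?P = "{S. S \<subseteq> {1..n} \<and> S \<noteq> {}}"
  have fP: "finite ?P"
    by (rule finite_subset[of _ "Pow {1..n}"]) auto
  \<comment> \<open>The subgraphs are partitioned by vertex set, which is nonempty by connectedness;
    below, the vertex sets are grouped by size.\<close>
  have "connected_subgraphs (complete_graph n) = (\<Union>S \<in> ?P. ?N S)"
    by (auto simp: connected_subgraphs_complete connected_graph_def)
  then have "core_index (complete_graph n) = (\<Sum>S \<in> ?P. card (?N S))"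
    unfolding core_index_def using fP
    by (subst card_UN_disjoint[symmetric])
      (auto intro!: finite_connected_graphs_on finite_subset[OF _ finite_atLeastAtMost])
  also have "\<dots> = (\<Sum>S \<in> ?P. num_connected_labeled (card S))"
    by (intro sum.cong card_connected_graphs_on) (auto intro: finite_subset)
  also have "\<dots> = (\<Sum>i = 1..n. \<Sum>S \<in> {S \<in> ?P. card S = i}. num_connected_labeled (card S))"
  proof (rule sum.group[symmetric, OF fP])
    show "card ` ?P \<subseteq> {1..n}"
      using card_mono[of "{1..n}"]
      by (auto simp: Suc_le_eq card_gt_0_iff dest: finite_subset[OF _ finite_atLeastAtMost])
  qed simp
  also have "\<dots> = (\<Sum>i = 1..n. (n choose i) * num_connected_labeled i)"
  proof (rule sum.cong[OF refl])
    fix i assume "i \<in> {1..n}"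
    \<comment> \<open>Since \<open>i\<close> is positive, every set of size \<open>i\<close> is
      nonempty and so lies in \<open>?P\<close> as soon as it is a subset of
      \<open>{1..n}\<close>.\<close>
    then have "{S \<in> ?P. card S = i} = {S. S \<subseteq> {1..n} \<and> card S = i}"
      by auto
    then show "(\<Sum>S \<in> {S \<in> ?P. card S = i}. num_connected_labeled (card S))
        = (n choose i) * num_connected_labeled i"
      using n_subsets[of "{1..n}" i] by simp
  qed
  finally show ?thesis .
qed

lemma connected_complete_graph:
  assumes "n \<ge> 1"
  shows "connected_graph (complete_graph n)"
proof (rule connected_graph_if_root)
  show "simple_graph (complete_graph n)"
    by (auto simp: simple_graph_def complete_graph_def)
  show "1 \<in> verts (complete_graph n)"
    using assms by (simp add: complete_graph_def)
  fix v assume "v \<in> verts (complete_graph n)"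
  then have "v = 1 \<or> (1, v) \<in> adj (complete_graph n)"
    using assms by (auto simp: complete_graph_def adj_def card_insert_if)
  then show "(1, v) \<in> (adj (complete_graph n))\<^sup>*"
    by auto
qed

lemma core_index_le_complete:
  assumes G: "simple_graph G"
  shows "core_index G \<le> core_index (complete_graph (card (verts G)))"
proof -
  let ?n = "card (verts G)"
  obtain f where "bij_betw f (verts G) {1..?n}"
    using G finite_same_card_bij[of "verts G" "{1..?n}"] by (auto simp: simple_graph_def)
  then have inj: "inj_on f (verts G)" and im: "f ` verts G = {1..?n}"
    by (auto simp: bij_betw_def)
  show ?thesis
    unfolding core_index_def
  proof (rule card_inj_on_le[where f = "map_graph f"])
    show "inj_on (map_graph f) (connected_subgraphs G)"
      by (rule inj_on_subset[OF inj_on_map_graph[OF inj]])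
        (auto simp: connected_subgraphs_def connected_graph_def)
    show "map_graph f ` connected_subgraphs G \<subseteq> connected_subgraphs (complete_graph ?n)"
    proof (rule image_subsetI)
      fix H assume "H \<in> connected_subgraphs G"
      then have H: "connected_graph H" "verts H \<subseteq> verts G"
        by (auto simp: connected_subgraphs_def)
      have "f ` verts H \<subseteq> {1..?n}"
        using H(2) im by blast
      then show "map_graph f H \<in> connected_subgraphs (complete_graph ?n)"
        using connected_map_graph[OF H(1) inj_on_subset[OF inj H(2)]]
        unfolding connected_subgraphs_complete by (simp add: map_graph_def)
    qed
    show "finite (connected_subgraphs (complete_graph ?n))"
      by (rule finite_connected_subgraphs) (auto simp: simple_graph_def complete_graph_def)
  qed
qed


subsection \<open>The path\<close>

lemma connected_path_graph:
  assumes "n \<ge> 1"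
  shows "connected_graph (path_graph n)"
proof (rule connected_graph_if_root)
  show "simple_graph (path_graph n)"
    by (auto simp: simple_graph_def path_graph_def)
  show "1 \<in> verts (path_graph n)"
    using assms by (simp add: path_graph_def)
  fix v assume "v \<in> verts (path_graph n)"
  then have "1 \<le> v" "v \<le> n"
    by (auto simp: path_graph_def)
  then show "(1, v) \<in> (adj (path_graph n))\<^sup>*"
  proof (induction v rule: dec_induct)
    case (step k)
    then have "(k, Suc k) \<in> adj (path_graph n)"
      by (auto simp: adj_def path_graph_def)
    with step show ?case
      by (meson Suc_leD rtrancl.rtrancl_into_rtrancl)
  qed simp
qed

text \<open>The cut \<open>{..i}\<close> separates \<open>u\<close> from \<open>v\<close>, and
  \<open>{i, i + 1}\<close> is the only edge of the path that crosses it.\<close>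

lemma connected_subgraph_path_edge:
  assumes H: "H \<in> connected_subgraphs (path_graph n)"
    and uv: "u \<in> verts H" "v \<in> verts H" "u \<le> i" "i < v"
  shows "{i, i + 1} \<in> edges H"
proof -
  have "(u, v) \<in> (adj H)\<^sup>*"
    using H uv by (auto simp: connected_subgraphs_def connected_graph_def)
  then obtain x y where e: "{x, y} \<in> edges H" "x \<le> i" "i < y"
    using uv crossing_edge[of u v H "{..i}"] by (metis atMost_iff not_le)
  then obtain j where "{x, y} = {j, j + 1}"
    using H by (auto simp: connected_subgraphs_def path_graph_def)
  with e have "x = i" "y = i + 1"
    by (auto simp: doubleton_eq_iff)
  with e show ?thesis
    by simp
qed

lemma connected_subgraph_path_eq:
  assumes H: "H \<in> connected_subgraphs (path_graph n)"
  defines "a \<equiv> Min (verts H)" and "b \<equiv> Max (verts H)"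
  shows "H = ({a..b}, {{i, i + 1} | i. a \<le> i \<and> i < b})" and "1 \<le> a" "a \<le> b" "b \<le> n"
proof -
  have cH: "connected_graph H" and sub: "verts H \<subseteq> {1..n}"
      and esub: "edges H \<subseteq> {{i, i + 1} | i. 1 \<le> i \<and> i < n}"
    using H by (auto simp: connected_subgraphs_def path_graph_def)
  then have fin: "finite (verts H)" and ne: "verts H \<noteq> {}" and Ev: "edges H \<subseteq> Pow (verts H)"
    using edges_subset_Pow by (auto simp: connected_graph_def simple_graph_def)
  have ab: "a \<in> verts H" "b \<in> verts H" and bd: "\<And>x. x \<in> verts H \<Longrightarrow> a \<le> x \<and> x \<le> b"
    unfolding a_def b_def using fin ne by auto
  show "1 \<le> a" "a \<le> b" "b \<le> n"
    using ab sub bd by auto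
  have edge: "{i, i + 1} \<in> edges H" if "a \<le> i" "i < b" for i
    using connected_subgraph_path_edge[OF H ab that] .
  have V: "verts H = {a..b}"
  proof
    show "{a..b} \<subseteq> verts H"
    proof
      fix i assume "i \<in> {a..b}"
      \<comment> \<open>Each vertex before \<open>b\<close> is an endpoint of an edge already known
        to be present; \<open>b\<close> itself starts no such edge.\<close>
      then have "i = b \<or> {i, i + 1} \<in> edges H"
        using edge by force
      then show "i \<in> verts H"
        using ab Ev by auto
    qed
  qed (use bd in auto)
  have E: "edges H = {{i, i + 1} | i. a \<le> i \<and> i < b}"
  proof
    show "edges H \<subseteq> {{i, i + 1} | i. a \<le> i \<and> i < b}"
    proof
      fix e assume e: "e \<in> edges H"
      then obtain i where i: "e = {i, i + 1}"
        using esub by auto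
      with e Ev V have "i \<in> {a..b}" "i + 1 \<in> {a..b}"
        by auto
      with i show "e \<in> {{i, i + 1} | i. a \<le> i \<and> i < b}"
        by auto
    qed
  qed (use edge in auto)
  from V E show "H = ({a..b}, {{i, i + 1} | i. a \<le> i \<and> i < b})"
    by (simp add: prod_eq_iff)
qed

lemma core_index_path:
  assumes "n \<ge> 1"
  shows "core_index (path_graph n) = (n + 1) choose 2"
proof (rule antisym)
  \<comment> \<open>The greater end \<open>b\<close> comes first, so that it leaves exactly
    \<open>b\<close> choices for \<open>a\<close> and \<open>?I\<close> has triangular size.
    Covering by the image of \<open>?g\<close> bounds the count from above; the reverse inequality
    is the general lower bound applied to the path.\<close>
  let ?I = "SIGMA b : {1..n}. {1..b}"
  let ?g = "\<lambda>(b, a). ({a..b}, {{i, i + 1} | i. a \<le> i \<and> i < b})"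
  have "connected_subgraphs (path_graph n) \<subseteq> ?g ` ?I"
  proof
    fix H assume "H \<in> connected_subgraphs (path_graph n)"
    note eq = connected_subgraph_path_eq[OF this]
    show "H \<in> ?g ` ?I"
      by (rule image_eqI[where x = "(Max (verts H), Min (verts H))"]) (use eq in auto)
  qed
  then have "core_index (path_graph n) \<le> card ?I"
    unfolding core_index_def by (rule surj_card_le[rotated]) auto
  also have "\<dots> = (\<Sum>b = 1..n. b)"
    by simp
  also have "\<dots> = (n + 1) choose 2"
    by (induction n) (simp_all add: numeral_2_eq_2)
  finally show "core_index (path_graph n) \<le> (n + 1) choose 2" .
  show "(n + 1) choose 2 \<le> core_index (path_graph n)"
    using core_index_ge[OF connected_path_graph[OF assms]] by (simp add: path_graph_def)
qed


theorem theorem2p1: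
  fixes n M :: nat
  assumes "n \<ge> 1"
    and "M = (\<Sum>i = 1..n. (n choose i) * num_connected_labeled i)"
  shows "(\<forall>G :: 'a ugraph. connected_graph G \<and> card (verts G) = n \<longrightarrow>
            ((n + 1) choose 2) \<le> core_index G \<and> core_index G \<le> M)
       \<and> (connected_graph (complete_graph n) \<and> card (verts (complete_graph n)) = n
            \<and> core_index (complete_graph n) = M
            \<and> (\<forall>G :: 'a ugraph. connected_graph G \<and> card (verts G) = n \<longrightarrow>
                 core_index G \<le> core_index (complete_graph n)))
       \<and> (connected_graph (path_graph n) \<and> card (verts (path_graph n)) = n
            \<and> core_index (path_graph n) = ((n + 1) choose 2)
            \<and> (\<forall>G :: 'a ugraph. connected_graph G \<and> card (verts G) = n \<longrightarrow>
                 core_index (path_graph n) \<le> core_index G))"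
proof -
  have cards: "card (verts (complete_graph n)) = n" "card (verts (path_graph n)) = n"
    by (simp_all add: complete_graph_def path_graph_def)
  have M: "core_index (complete_graph n) = M"
    by (simp add: assms(2) core_index_complete)
  have lower: "(n + 1) choose 2 \<le> core_index G" and upper: "core_index G \<le> M"
    if "connected_graph G \<and> card (verts G) = n" for G :: "'a ugraph"
    using that core_index_ge[of G n] core_index_le_complete[of G] M connected_graph_simple[of G]
    by simp_all
  \<comment> \<open>Given the exact values for the complete graph and the path, both extremality
    claims restate \<open>upper\<close> and \<open>lower\<close>.\<close>
  show ?thesis
    using lower upper M cards core_index_path[OF assms(1)]
      connected_complete_graph[OF assms(1)] connected_path_graph[OF assms(1)]
    by simp
qed

end
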